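(* Let $A$ be an associative real composition algebra, let $\mathcal{O}$ be an $R$-order in $A$ ($R\in\{\mathbb{Z},\mathbb{Z}[\varphi]\}$), and suppose that $U=\mathcal{S}_1(\mathcal{O})\subset A^\times$ is a finite subgroup. The map $$\pi:U\times U\to U,\qquad \pi(u,v)=uv^{-1},$$ is surjective and exhibits $U\times U$ as a trivial principal $U$-fibration over $U$: every fibre has cardinality $|U|$, and the section $U\to U\times U$, $w\mapsto(w,1)$, is global.
   Context: $\varphi=(1+\sqrt5)/2$. $A$ is one of the associative algebras $\mathbb{R},\mathbb{C},\mathbb{H}$ with its standard positive definite multiplicative norm $N$, polar form $B(x,y)=N(x+y)-N(x)-N(y)=x\bar y+y\bar x$ and conjugation $\bar x=B(x,1)\cdot1-x$. An $R$-order in $A$ is a finitely generated $R$-submodule $\mathcal{O}\subset A$ with $1\in\mathcal{O}$, $\overline{\mathcal{O}}=\mathcal{O}$, $\mathcal{O}\cdot\mathcal{O}\subseteq\mathcal{O}$, $N(\mathcal{O})\subseteq R$, and $B$ restricting to an $R$-bilinear map $\mathcal{O}\times\mathcal{O}\to R$. $\mathcal{S}_1(\mathcal{O})=\{x\in\mathcal{O}:N(x)=1\}$, on which $v^{-1}=\bar v$. The principal structure is taken with respect to the right-diagonal action $(u,v)\cdot g=(ug,vg)$ of $U$ on $U\times U$: $\pi$ is a principal $U$-fibration if this action is free and its orbits are exactly the fibres of $\pi$, and it is trivial if $\pi$ admits a global section. *)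

theory Defs
  imports Complex_Main "HOL-Algebra.Coset"
begin

datatype quat = Quat (qRe: real) (qI: real) (qJ: real) (qK: real)

lemma quat_eq_iff:
  "x = y \<longleftrightarrow> qRe x = qRe y \<and> qI x = qI y \<and> qJ x = qJ y \<and> qK x = qK y"
  by (cases x; cases y) simp

instantiation quat :: real_algebra_1
begin

definition zero_quat :: quat where "0 = Quat 0 0 0 0"
definition one_quat :: quat where "1 = Quat 1 0 0 0"

definition plus_quat :: "quat \<Rightarrow> quat \<Rightarrow> quat" where
  "x + y = Quat (qRe x + qRe y) (qI x + qI y) (qJ x + qJ y) (qK x + qK y)"

definition uminus_quat :: "quat \<Rightarrow> quat" where
  "- x = Quat (- qRe x) (- qI x) (- qJ x) (- qK x)"

definition minus_quat :: "quat \<Rightarrow> quat \<Rightarrow> quat" where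
  "x - y = Quat (qRe x - qRe y) (qI x - qI y) (qJ x - qJ y) (qK x - qK y)"

definition scaleR_quat :: "real \<Rightarrow> quat \<Rightarrow> quat" where
  "r *\<^sub>R x = Quat (r * qRe x) (r * qI x) (r * qJ x) (r * qK x)"

definition times_quat :: "quat \<Rightarrow> quat \<Rightarrow> quat" where
  "x * y = Quat
     (qRe x * qRe y - qI x * qI y - qJ x * qJ y - qK x * qK y)
     (qRe x * qI y + qI x * qRe y + qJ x * qK y - qK x * qJ y)
     (qRe x * qJ y - qI x * qK y + qJ x * qRe y + qK x * qI y)
     (qRe x * qK y + qI x * qJ y - qJ x * qI y + qK x * qRe y)"

instance
  by standard
    (simp_all add: quat_eq_iff zero_quat_def one_quat_def plus_quat_def uminus_quat_def
      minus_quat_def scaleR_quat_def times_quat_def algebra_simps)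

end

definition norm_real :: "real \<Rightarrow> real" where
  "norm_real x = x\<^sup>2"

definition norm_complex :: "complex \<Rightarrow> real" where
  "norm_complex z = (cmod z)\<^sup>2"

definition norm_quat :: "quat \<Rightarrow> real" where
  "norm_quat q = (qRe q)\<^sup>2 + (qI q)\<^sup>2 + (qJ q)\<^sup>2 + (qK q)\<^sup>2"

definition normed_algebra_iso ::
  "('a::real_algebra_1 \<Rightarrow> real) \<Rightarrow> ('b::real_algebra_1 \<Rightarrow> real) \<Rightarrow> ('a \<Rightarrow> 'b) \<Rightarrow> bool" where
  "normed_algebra_iso N N' f \<longleftrightarrow>
     linear f \<and> bij f \<and> f 1 = 1 \<and> (\<forall>x y. f (x * y) = f x * f y) \<and> (\<forall>x. N' (f x) = N x)"

text \<open>The algebra is the whole type; \<open>N\<close> is its norm. The algebra is one of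
  the reals, the complex numbers and the quaternions, up to an isomorphism that carries \<open>N\<close>
  to the standard norm.\<close>

definition assoc_composition_algebra :: "('a::real_algebra_1 \<Rightarrow> real) \<Rightarrow> bool" where
  "assoc_composition_algebra N \<longleftrightarrow>
     (\<exists>f. normed_algebra_iso N norm_real f) \<or>
     (\<exists>f. normed_algebra_iso N norm_complex f) \<or>
     (\<exists>f. normed_algebra_iso N norm_quat f)"

lemma assoc_composition_algebra_standard:
  "assoc_composition_algebra norm_real"
  "assoc_composition_algebra norm_complex"
  "assoc_composition_algebra norm_quat"
proof -
  have "normed_algebra_iso N N (\<lambda>x. x)" for N :: "'b::real_algebra_1 \<Rightarrow> real"
    by (simp add: normed_algebra_iso_def linear_iff bij_def)
  then show "assoc_composition_algebra norm_real" "assoc_composition_algebra norm_complex"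
    "assoc_composition_algebra norm_quat"
    unfolding assoc_composition_algebra_def by blast+
qed

definition polar :: "('a::real_algebra_1 \<Rightarrow> real) \<Rightarrow> 'a \<Rightarrow> 'a \<Rightarrow> real" where
  "polar N x y = N (x + y) - N x - N y"

definition conjugate :: "('a::real_algebra_1 \<Rightarrow> real) \<Rightarrow> 'a \<Rightarrow> 'a" where
  "conjugate N x = polar N x 1 *\<^sub>R 1 - x"

definition golden_ratio :: real where
  "golden_ratio = (1 + sqrt 5) / 2"

text \<open>Linear combinations suffice for the generated ring, because the square of the golden
  ratio is the golden ratio plus one.\<close>

definition Ints_golden :: "real set" where
  "Ints_golden = {of_int a + of_int b * golden_ratio | a b. True}"

lemma golden_ratio_squared: "golden_ratio\<^sup>2 = golden_ratio + 1"
  by (simp add: golden_ratio_def power2_eq_square field_simps)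

text \<open>In the following, \<open>R\<close> is a subring of the reals.\<close>

definition submodule_over :: "real set \<Rightarrow> 'a::real_vector set \<Rightarrow> bool" where
  "submodule_over R M \<longleftrightarrow>
     0 \<in> M \<and> (\<forall>x\<in>M. \<forall>y\<in>M. x + y \<in> M) \<and> (\<forall>r\<in>R. \<forall>x\<in>M. r *\<^sub>R x \<in> M)"

definition finitely_generated_over :: "real set \<Rightarrow> 'a::real_vector set \<Rightarrow> bool" where
  "finitely_generated_over R M \<longleftrightarrow>
     (\<exists>S. finite S \<and> S \<subseteq> M \<and>
        (\<forall>x\<in>M. \<exists>c. (\<forall>s\<in>S. c s \<in> R) \<and> x = (\<Sum>s\<in>S. c s *\<^sub>R s)))"

definition bilinear_over ::
  "real set \<Rightarrow> 'a::real_vector set \<Rightarrow> ('a \<Rightarrow> 'a \<Rightarrow> real) \<Rightarrow> bool" where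
  "bilinear_over R M b \<longleftrightarrow>
     (\<forall>x\<in>M. \<forall>y\<in>M. b x y \<in> R) \<and>
     (\<forall>x\<in>M. \<forall>y\<in>M. \<forall>z\<in>M. b (x + y) z = b x z + b y z \<and> b x (y + z) = b x y + b x z) \<and>
     (\<forall>r\<in>R. \<forall>x\<in>M. \<forall>y\<in>M. b (r *\<^sub>R x) y = r * b x y \<and> b x (r *\<^sub>R y) = r * b x y)"

definition is_order :: "('a::real_algebra_1 \<Rightarrow> real) \<Rightarrow> real set \<Rightarrow> 'a set \<Rightarrow> bool" where
  "is_order N R \<O> \<longleftrightarrow>
     submodule_over R \<O> \<and> finitely_generated_over R \<O> \<and>
     1 \<in> \<O> \<and> conjugate N ` \<O> = \<O> \<and> (\<forall>x\<in>\<O>. \<forall>y\<in>\<O>. x * y \<in> \<O>) \<and>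
     N ` \<O> \<subseteq> R \<and> bilinear_over R \<O> (polar N)"

definition unit_norm :: "('a::real_algebra_1 \<Rightarrow> real) \<Rightarrow> 'a set \<Rightarrow> 'a set" where
  "unit_norm N \<O> = {x \<in> \<O>. N x = 1}"

definition unit_group :: "'a::monoid_mult monoid" where
  "unit_group = units_of \<lparr>carrier = UNIV, mult = (*), one = 1\<rparr>"

definition right_action ::
  "('g, 'm) monoid_scheme \<Rightarrow> 'e set \<Rightarrow> ('e \<Rightarrow> 'g \<Rightarrow> 'e) \<Rightarrow> bool" where
  "right_action G E act \<longleftrightarrow>
     (\<forall>p\<in>E. \<forall>g\<in>carrier G. act p g \<in> E) \<and>
     (\<forall>p\<in>E. act p \<one>\<^bsub>G\<^esub> = p) \<and>
     (\<forall>p\<in>E. \<forall>g\<in>carrier G. \<forall>h\<in>carrier G. act (act p g) h = act p (g \<otimes>\<^bsub>G\<^esub> h))"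

definition free_action ::
  "('g, 'm) monoid_scheme \<Rightarrow> 'e set \<Rightarrow> ('e \<Rightarrow> 'g \<Rightarrow> 'e) \<Rightarrow> bool" where
  "free_action G E act \<longleftrightarrow> (\<forall>p\<in>E. \<forall>g\<in>carrier G. act p g = p \<longrightarrow> g = \<one>\<^bsub>G\<^esub>)"

definition fibre :: "'e set \<Rightarrow> ('e \<Rightarrow> 'b) \<Rightarrow> 'b \<Rightarrow> 'e set" where
  "fibre E \<pi> b = {p \<in> E. \<pi> p = b}"

definition principal_fibration ::
  "('g, 'm) monoid_scheme \<Rightarrow> ('e \<Rightarrow> 'g \<Rightarrow> 'e) \<Rightarrow> 'e set \<Rightarrow> 'b set \<Rightarrow> ('e \<Rightarrow> 'b) \<Rightarrow> bool" where
  "principal_fibration G act E B \<pi> \<longleftrightarrow>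
     group G \<and> \<pi> ` E \<subseteq> B \<and> right_action G E act \<and> free_action G E act \<and>
     {act p ` carrier G | p. p \<in> E} = {fibre E \<pi> b | b. b \<in> B}"

definition global_section :: "'e set \<Rightarrow> 'b set \<Rightarrow> ('e \<Rightarrow> 'b) \<Rightarrow> ('b \<Rightarrow> 'e) \<Rightarrow> bool" where
  "global_section E B \<pi> s \<longleftrightarrow> (\<forall>b\<in>B. s b \<in> E \<and> \<pi> (s b) = b)"

definition trivial_principal_fibration ::
  "('g, 'm) monoid_scheme \<Rightarrow> ('e \<Rightarrow> 'g \<Rightarrow> 'e) \<Rightarrow> 'e set \<Rightarrow> 'b set \<Rightarrow> ('e \<Rightarrow> 'b) \<Rightarrow> bool" where
  "trivial_principal_fibration G act E B \<pi> \<longleftrightarrow>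
     principal_fibration G act E B \<pi> \<and> (\<exists>s. global_section E B \<pi> s)"

end

theory Submission
  imports Defs
begin

text \<open>
  The statement holds for a subgroup \<open>U\<close> of any group. The equation \<open>u v\<^sup>-\<^sup>1 = w\<close> says
  \<open>u = w v\<close>, so the fibre of \<open>(u, v) \<mapsto> u v\<^sup>-\<^sup>1\<close> over \<open>w\<close> is the graph
  \<open>{(w g, g) | g \<in> U}\<close> (lemma \<open>fibre_eq_graph\<close>). It is in bijection with \<open>U\<close> through its second
  coordinate, and it is also the orbit of \<open>(w, 1)\<close> under the diagonal right action.
  More generally \<open>(u, v) = (w, 1) \<cdot> v\<close> with \<open>w = u v\<^sup>-\<^sup>1\<close>, so every orbit is the fibre over the
  quotient of any of its points (lemma \<open>diagonal_orbit_eq_fibre\<close>). The action is free because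
  right translation already is, and \<open>w \<mapsto> (w, 1)\<close> is a section.
  What remains is that the invertible elements of an associative algebra form a group, whose
  operation is the multiplication of the algebra.
\<close>

context group
begin

definition quotient_map :: "'a \<times> 'a \<Rightarrow> 'a" where
  "quotient_map = (\<lambda>(u, v). u \<otimes> inv v)"

definition diagonal_action :: "'a \<times> 'a \<Rightarrow> 'a \<Rightarrow> 'a \<times> 'a" where
  "diagonal_action = (\<lambda>(u, v) g. (u \<otimes> g, v \<otimes> g))"

lemma quotient_map_mem:
  assumes "subgroup U G" and "p \<in> U \<times> U"
  shows "quotient_map p \<in> U"
  using assms by (auto simp: quotient_map_def subgroup.m_closed subgroup.m_inv_closed)

lemma global_section_quotient_map:
  assumes "subgroup U G"
  shows "global_section (U \<times> U) U quotient_map (\<lambda>w. (w, \<one>))"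
  using assms
  by (auto simp: global_section_def quotient_map_def subgroup.one_closed subgroup.mem_carrier)

lemma quotient_map_image:
  assumes "subgroup U G"
  shows "quotient_map ` (U \<times> U) = U"
proof
  show "quotient_map ` (U \<times> U) \<subseteq> U"
    using quotient_map_mem[OF assms] by blast
  show "U \<subseteq> quotient_map ` (U \<times> U)"
    using global_section_quotient_map[OF assms] by (force simp: global_section_def)
qed

text \<open>Right multiplication by \<open>v\<close> turns \<open>u v\<^sup>-\<^sup>1 = w\<close> into \<open>u = w v\<close>, so a point of the fibre is
  determined by its second coordinate, which is arbitrary.\<close>

lemma fibre_eq_graph:
  assumes "subgroup U G" and "w \<in> U"
  shows "fibre (U \<times> U) quotient_map w = (\<lambda>g. (w \<otimes> g, g)) ` U"
proof -
  have "u \<otimes> inv v = w \<longleftrightarrow> u = w \<otimes> v" if "u \<in> U" "v \<in> U" for u v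
    using that assms(2) subgroup.mem_carrier[OF assms(1)] by (auto simp: m_assoc)
  then show ?thesis
    using assms by (auto simp: fibre_def quotient_map_def subgroup.m_closed)
qed

lemma card_fibre_quotient_map:
  assumes "subgroup U G" and "w \<in> U"
  shows "card (fibre (U \<times> U) quotient_map w) = card U"
  unfolding fibre_eq_graph[OF assms] by (rule card_image) (simp add: inj_on_def)

text \<open>With \<open>w = u v\<^sup>-\<^sup>1\<close>, the point \<open>(u g, v g)\<close> is \<open>(w h, h)\<close> for \<open>h = v g\<close>, and left
  multiplication by \<open>v\<close> permutes \<open>U\<close>; so the orbit is the graph that forms the fibre.\<close>

lemma diagonal_orbit_eq_fibre:
  assumes "subgroup U G" and "u \<in> U" and "v \<in> U"
  shows "diagonal_action (u, v) ` U = fibre (U \<times> U) quotient_map (u \<otimes> inv v)"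
proof -
  note closed = subgroup.m_closed[OF assms(1)] subgroup.m_inv_closed[OF assms(1)]
  note car = subgroup.mem_carrier[OF assms(1)]
  have "diagonal_action (u, v) g = (\<lambda>h. ((u \<otimes> inv v) \<otimes> h, h)) (v \<otimes> g)" if "g \<in> U" for g
    using that assms car by (simp add: diagonal_action_def m_assoc inv_solve_left)
  moreover have "(\<lambda>g. v \<otimes> g) ` U = U"
  proof
    show "(\<lambda>g. v \<otimes> g) ` U \<subseteq> U"
      using assms closed by blast
    have "h = v \<otimes> (inv v \<otimes> h)" if "h \<in> U" for h
      using that assms car by (simp add: m_assoc[symmetric])
    then show "U \<subseteq> (\<lambda>g. v \<otimes> g) ` U"
      using assms closed by blast
  qed
  ultimately have "diagonal_action (u, v) ` U = (\<lambda>h. ((u \<otimes> inv v) \<otimes> h, h)) ` U"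
    by (metis (no_types, lifting) image_cong image_image)
  then show ?thesis
    using fibre_eq_graph[OF assms(1)] assms closed by simp
qed

lemma trivial_principal_fibration_quotient_map:
  assumes "subgroup U G"
  shows "trivial_principal_fibration (G\<lparr>carrier := U\<rparr>) diagonal_action (U \<times> U) U quotient_map"
  unfolding trivial_principal_fibration_def principal_fibration_def
proof (intro conjI)
  note closed = subgroup.m_closed[OF assms]
  note car = subgroup.mem_carrier[OF assms]
  show "group (G\<lparr>carrier := U\<rparr>)"
    using assms by (rule subgroup_imp_group)
  show "quotient_map ` (U \<times> U) \<subseteq> U"
    using quotient_map_image[OF assms] by simp
  show "right_action (G\<lparr>carrier := U\<rparr>) (U \<times> U) diagonal_action"
    using closed car by (auto simp: right_action_def diagonal_action_def m_assoc)
  show "free_action (G\<lparr>carrier := U\<rparr>) (U \<times> U) diagonal_action"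
    using car by (auto simp: free_action_def diagonal_action_def)
  show "{diagonal_action p ` carrier (G\<lparr>carrier := U\<rparr>) |p. p \<in> U \<times> U} =
      {fibre (U \<times> U) quotient_map b |b. b \<in> U}" (is "?orbits = ?fibres")
  proof -
    have "?orbits = (\<lambda>p. diagonal_action p ` U) ` (U \<times> U)"
      by auto
    also have "\<dots> = (\<lambda>p. fibre (U \<times> U) quotient_map (quotient_map p)) ` (U \<times> U)"
      using diagonal_orbit_eq_fibre[OF assms] by (intro image_cong) (auto simp: quotient_map_def)
    also have "\<dots> = fibre (U \<times> U) quotient_map ` U"
      by (metis image_image quotient_map_image[OF assms])
    also have "\<dots> = ?fibres"
      by auto
    finally show ?thesis .
  qed
  show "\<exists>s. global_section (U \<times> U) U quotient_map s"
    using global_section_quotient_map[OF assms] by blast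
qed

end

lemma group_unit_group: "group (unit_group :: 'a::monoid_mult monoid)"
proof -
  have "Group.monoid (\<lparr>carrier = UNIV, mult = (*), one = 1\<rparr> :: 'a monoid)"
    by (rule Group.monoidI) (simp_all add: mult.assoc)
  then show ?thesis
    unfolding unit_group_def by (rule Group.monoid.units_group)
qed

lemma unit_group_simps:
  "mult unit_group = (*)" "one unit_group = 1"
  by (simp_all add: unit_group_def units_of_def)

theorem theorem7p4:
  fixes N :: "'a::real_algebra_1 \<Rightarrow> real"
    and R :: "real set"
    and \<O> U :: "'a set"
    and \<pi> :: "'a \<times> 'a \<Rightarrow> 'a"
  assumes "assoc_composition_algebra N"
    and "R \<in> {\<int>, Ints_golden}"
    and "is_order N R \<O>"
    and "U = unit_norm N \<O>"
    and "subgroup U unit_group"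
    and "finite U"
    and "\<pi> = (\<lambda>(u, v). u * inv\<^bsub>unit_group\<^esub> v)"
  shows "\<pi> ` (U \<times> U) = U \<and>
    trivial_principal_fibration (unit_group\<lparr>carrier := U\<rparr>) (\<lambda>(u, v) g. (u * g, v * g))
      (U \<times> U) U \<pi> \<and>
    (\<forall>w\<in>U. card (fibre (U \<times> U) \<pi> w) = card U) \<and>
    global_section (U \<times> U) U \<pi> (\<lambda>w. (w, 1))"
proof -
  interpret group "unit_group :: 'a monoid"
    by (rule group_unit_group)
  have proj: "\<pi> = quotient_map"
    using assms(7) by (simp add: quotient_map_def unit_group_simps)
  have action: "diagonal_action = (\<lambda>(u, v) g. (u * g, v * g))"
    by (simp add: diagonal_action_def unit_group_simps)
  note U = \<open>subgroup U unit_group\<close>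
  show ?thesis
    unfolding proj action[symmetric]
    using quotient_map_image[OF U] trivial_principal_fibration_quotient_map[OF U]
      card_fibre_quotient_map[OF U] global_section_quotient_map[OF U]
    by (simp add: unit_group_simps)
qed

end
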